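(* Let $\mathcal{N}\subseteq\mathbb{V}^{m\times n}$ be a nonempty open set, let $g:\mathbb{R}^m\to\mathbb{R}^m$ be absolutely symmetric on an open set $\hat\sigma_{\mathcal{N}}\subseteq\mathbb{R}^m$ containing $\{\sigma(X)\mid X\in\mathcal{N}\}$, and let $G:\mathcal{N}\to\mathbb{V}^{m\times n}$ be the spectral operator with respect to $g$. Let $\overline{X}\in\mathcal{N}$. Then $G$ is continuous at $\overline{X}$ if and only if $g$ is continuous at $\sigma(\overline{X})$.
   Context: Fix $m\le n$. $\mathbb{V}^{m\times n}$ denotes either $\mathbb{R}^{m\times n}$ or $\mathbb{C}^{m\times n}$, viewed as a real Euclidean space with inner product $\langle X,Y\rangle=\mathrm{Re}(\mathrm{trace}(X^{*}Y))$ and induced norm, where $X^{*}$ is the (conjugate) transpose. $\mathbb{O}^p$ is the set of $p\times p$ orthogonal (real case) or unitary (complex case) matrices. $\sigma(Z)\in\mathbb{R}^m$ is the vector of singular values $\sigma_1(Z)\ge\cdots\ge\sigma_m(Z)\ge0$ of $Z\in\mathbb{V}^{m\times n}$; $\mathrm{Diag}(x)$ is the diagonal matrix with diagonal $x$; $\mathbb{O}^{m,n}(Z)$ is the set of pairs $(U,V)\in\mathbb{O}^m\times\mathbb{O}^n$ with $Z=U[\mathrm{Diag}(\sigma(Z))\quad 0]V^{*}$. A signed permutation matrix is a square matrix with exactly one nonzero entry in each row and each column, that entry being $\pm1$. The mapping $g:\mathbb{R}^m\to\mathbb{R}^m$ is absolutely symmetric on a set $D$ if $g(Qx)=Qg(x)$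 for every $x\in D$ and every $m\times m$ signed permutation matrix $Q$. The spectral operator $G$ with respect to $g$ is $G(X)=U[\mathrm{Diag}(g(\sigma(X)))\quad 0]V^{*}$ for $X\in\mathcal{N}$, where $(U,V)\in\mathbb{O}^{m,n}(X)$ (the value does not depend on the choice of $(U,V)$). *)

theory Defs
  imports "HOL-Analysis.Analysis"
begin

text \<open>
  The scalar fields \<open>\<real>\<close> and \<open>\<complex>\<close>, treated uniformly. The axioms force \<open>x + conjugate x\<close> and
  \<open>x * conjugate x\<close> to be real, so every element is a root of a real quadratic polynomial;
  hence, up to isomorphism, the two instances below are the only ones.
\<close>

class real_or_complex = real_normed_field + euclidean_space +
  fixes conjugate :: "'a \<Rightarrow> 'a"
  assumes conjugate_add: "conjugate (x + y) = conjugate x + conjugate y"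
    and conjugate_mult: "conjugate (x * y) = conjugate x * conjugate y"
    and conjugate_conjugate: "conjugate (conjugate x) = x"
    and mult_conjugate: "x * conjugate x = (norm x)\<^sup>2 *\<^sub>R 1"

instantiation real :: real_or_complex
begin
definition conjugate_real :: "real \<Rightarrow> real" where "conjugate_real x = x"
instance by standard (simp_all add: conjugate_real_def power2_eq_square)
end

instantiation complex :: real_or_complex
begin
definition conjugate_complex :: "complex \<Rightarrow> complex" where "conjugate_complex = cnj"
instance
  by standard (simp_all add: conjugate_complex_def complex_norm_square[symmetric] scaleR_conv_of_real)
end

definition conj_transpose :: "'a::real_or_complex^'n^'m \<Rightarrow> 'a^'m^'n" where
  "conj_transpose X = (\<chi> j i. conjugate (X $ i $ j))"

definition unitary_matrix :: "'a::real_or_complex^'p^'p \<Rightarrow> bool" where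
  "unitary_matrix U \<longleftrightarrow> conj_transpose U ** U = mat 1 \<and> U ** conj_transpose U = mat 1"

lemma conj_transpose_real: "conj_transpose X = transpose X" for X :: "real^'n^'m"
  by (simp add: conj_transpose_def transpose_def conjugate_real_def)

lemma unitary_matrix_real: "unitary_matrix U \<longleftrightarrow> orthogonal_matrix U" for U :: "real^'p^'p"
  by (simp add: unitary_matrix_def orthogonal_matrix_def conj_transpose_real)

text \<open>
  The library's inner product on matrices is \<open>Re (trace (X\<^sup>* Y))\<close>; in both fields
  \<open>z \<bullet> 1\<close> is the real part of \<open>z\<close>.
\<close>

lemma inner_matrix_real: "X \<bullet> Y = trace (conj_transpose X ** Y)" for X Y :: "real^'n^'m"
  by (simp add: inner_vec_def trace_def matrix_matrix_mult_def conj_transpose_def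
      conjugate_real_def sum.swap[of _ "UNIV :: 'n set"])

lemma inner_matrix_complex: "X \<bullet> Y = Re (trace (conj_transpose X ** Y))" for X Y :: "complex^'n^'m"
  by (simp add: inner_vec_def trace_def matrix_matrix_mult_def conj_transpose_def
      conjugate_complex_def inner_complex_def sum.swap[of _ "UNIV :: 'n set"])

text \<open>
  Rows and columns are indexed by finite linearly ordered types, the \<open>k\<close>-th smallest index playing
  the role of \<open>k\<close>. So \<open>rect_diag x\<close> is the \<open>m \<times> n\<close> matrix \<open>[Diag(x) 0]\<close>
  (with \<open>m \<le> n\<close>).
\<close>

definition index_rank :: "'i::{finite,linorder} \<Rightarrow> nat" where
  "index_rank i = card {k. k < i}"

definition rect_diag ::
  "real^'m::{finite,linorder} \<Rightarrow> 'a::real_or_complex^'n::{finite,linorder}^'m::_" where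
  "rect_diag x = (\<chi> i j. if index_rank i = index_rank j then of_real (x $ i) else 0)"

text \<open>
  For \<open>m \<le> n\<close> the singular values of \<open>Z\<close> are the nonnegative square roots of the
  eigenvalues of the \<open>m \<times> m\<close> matrix \<open>Z Z\<^sup>*\<close>, repeated according to their multiplicity in the
  characteristic polynomial and listed in nonincreasing order.
\<close>

definition singular_values ::
  "'a::real_or_complex^'n^'m::{finite,linorder} \<Rightarrow> real^'m::_" where
  "singular_values Z = (THE s. (\<forall>i j. i \<le> j \<longrightarrow> s $ j \<le> s $ i) \<and> (\<forall>i. 0 \<le> s $ i) \<and>
     (\<forall>t. det (mat t - Z ** conj_transpose Z) = (\<Prod>i\<in>UNIV. t - of_real ((s $ i)\<^sup>2))))"

definition svd_pairs ::
  "'a::real_or_complex^'n::{finite,linorder}^'m::{finite,linorder} \<Rightarrow>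
   (('a^'m::_^'m::_) \<times> ('a^'n::_^'n::_)) set" where
  "svd_pairs Z = {(U, V). unitary_matrix U \<and> unitary_matrix V \<and>
     Z = U ** rect_diag (singular_values Z) ** conj_transpose V}"

definition signed_permutation_matrix :: "real^'m^'m \<Rightarrow> bool" where
  "signed_permutation_matrix Q \<longleftrightarrow>
     (\<forall>i. \<exists>!j. Q $ i $ j \<noteq> 0) \<and> (\<forall>j. \<exists>!i. Q $ i $ j \<noteq> 0) \<and>
     (\<forall>i j. Q $ i $ j \<noteq> 0 \<longrightarrow> Q $ i $ j = 1 \<or> Q $ i $ j = -1)"

definition absolutely_symmetric_on :: "(real^'m) set \<Rightarrow> (real^'m \<Rightarrow> real^'m) \<Rightarrow> bool" where
  "absolutely_symmetric_on D g \<longleftrightarrow>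
     (\<forall>x\<in>D. \<forall>Q. signed_permutation_matrix Q \<longrightarrow> g (Q *v x) = Q *v g x)"

text \<open>
  The description is unique, i.e. independent of the choice of \<open>(U, V)\<close>, whenever \<open>g\<close> is
  absolutely symmetric on a set containing \<open>singular_values X\<close>.
\<close>

definition spectral_operator ::
  "(real^'m::_ \<Rightarrow> real^'m::_) \<Rightarrow>
   'a::real_or_complex^'n::{finite,linorder}^'m::{finite,linorder} \<Rightarrow>
   'a^'n::_^'m::_" where
  "spectral_operator g X = (THE Y. \<exists>(U, V)\<in>svd_pairs X.
     Y = U ** rect_diag (g (singular_values X)) ** conj_transpose V)"

end

theory Submission
  imports Defs
begin

text \<open>
  Write \<open>S x\<close> for \<open>rect_diag x\<close>. Both implications rest on one identity: \<open>G\<close> maps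
  \<open>U S(x) V\<^sup>*\<close> to \<open>U S(g x) V\<^sup>*\<close> for all unitary \<open>U\<close>, \<open>V\<close> and all \<open>x \<in> D\<close>, also when
  the entries of \<open>x\<close> are unsorted or negative (\<open>spectral_operator_rect_diag\<close>).

  If \<open>G\<close> is continuous at \<open>X = U S(\<sigma>) V\<^sup>*\<close>, then \<open>x \<mapsto> U S(x) V\<^sup>*\<close> is a continuous family of
  matrices through \<open>X\<close>, and \<open>S(g x) = U\<^sup>* G(U S(x) V\<^sup>*) V\<close> shows that \<open>g\<close> is continuous at
  \<open>\<sigma>\<close>.

  Conversely, let \<open>g\<close> be continuous at \<open>\<sigma>(X)\<close> and let \<open>Z\<^sub>k \<rightarrow> X\<close> have decompositions
  \<open>U\<^sub>k S(\<sigma>(Z\<^sub>k)) V\<^sub>k\<^sup>*\<close>. The unitary matrices form a compact set, so along a subsequence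
  \<open>U\<^sub>k \<rightarrow> U\<close> and \<open>V\<^sub>k \<rightarrow> V\<close>; then \<open>S(\<sigma>(Z\<^sub>k)) = U\<^sub>k\<^sup>* Z\<^sub>k V\<^sub>k\<close> converges as well, its limit is
  \<open>S(\<sigma>(X))\<close>, and \<open>(U, V)\<close> decomposes \<open>X\<close> (\<open>svd_subsequence_convergent\<close>). Hence
  \<open>G(Z\<^sub>k) = U\<^sub>k S(g(\<sigma>(Z\<^sub>k))) V\<^sub>k\<^sup>*\<close> tends to \<open>U S(g(\<sigma>(X))) V\<^sup>* = G(X)\<close> along that subsequence,
  so no sequence can keep \<open>G(Z\<^sub>k)\<close> away from \<open>G(X)\<close>.

  The identity for \<open>G\<close> comes from \<open>rect_diag_commute\<close>: two decompositions of a matrix with the same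
  \<open>x\<close> differ by unitary matrices that intertwine with \<open>S(x)\<close>; these have a block structure given
  by the coincidences \<open>x\<^sub>i = \<plusminus> x\<^sub>j\<close>, and absolute symmetry says that \<open>g(x)\<close> has the same
  coincidences. Signed permutations relate an arbitrary \<open>x\<close> to the sorted nonnegative vector of
  singular values.

  The existence of singular value decompositions over both fields at once is obtained by
  maximizing the real inner product of \<open>Z\<close> with \<open>U S(c) V\<^sup>*\<close> over unitary \<open>U\<close>, \<open>V\<close>, for a fixed
  \<open>c\<close> with distinct positive entries (\<open>svd_exists\<close>). That the singular values are determined by \<open>Z\<close>
  is read off from the characteristic polynomial of \<open>Z Z\<^sup>*\<close> (\<open>singular_values_eq\<close>).
\<close>

section \<open>Conjugation, adjoints and the real inner product\<close>

lemma conjugate_0 [simp]: "conjugate (0::'a::real_or_complex) = 0"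
  using conjugate_add[of "0::'a" 0] by simp

lemma conjugate_of_real [simp]: "conjugate (of_real r :: 'a::real_or_complex) = of_real r"
proof (cases "r = 0")
  case False
  have "of_real r * conjugate (of_real r :: 'a) = of_real r * of_real r"
    using mult_conjugate[of "of_real r :: 'a"]
    by (simp add: scaleR_conv_of_real power2_eq_square flip: of_real_mult)
  with False show ?thesis by simp
qed simp

lemma conjugate_1 [simp]: "conjugate (1::'a::real_or_complex) = 1"
  using conjugate_of_real[of 1, where 'a='a] by simp

lemma conjugate_minus [simp]: "conjugate (- x) = - conjugate (x::'a::real_or_complex)"
  using conjugate_add[of x "- x"] by (simp add: minus_unique)

lemma conjugate_sum: "conjugate (sum f S) = (\<Sum>i\<in>S. conjugate (f i :: 'a::real_or_complex))"
  by (induction S rule: infinite_finite_induct) (simp_all add: conjugate_add)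

lemma norm_conjugate [simp]: "norm (conjugate x) = norm (x::'a::real_or_complex)"
proof (cases "x = 0")
  case False
  have "norm x * norm (conjugate x) = norm x * norm x"
    using arg_cong[OF mult_conjugate[of x], of norm] by (simp add: norm_mult power2_eq_square)
  with False show ?thesis by simp
qed simp

lemma bounded_linear_conjugate: "bounded_linear (conjugate :: 'a::real_or_complex \<Rightarrow> 'a)"
proof (rule bounded_linear_intro[where K = 1])
  show "conjugate (r *\<^sub>R x) = r *\<^sub>R conjugate x" for r and x :: 'a
    by (simp add: scaleR_conv_of_real conjugate_mult)
qed (simp_all add: conjugate_add)

lemma inner_mult_mult:
  "inner (a * x) (a * y) = (norm a)\<^sup>2 * inner x (y::'a::real_or_complex)"
proof -
  have "inner (a * x) (a * y) = ((norm (a * x + a * y))\<^sup>2 - (norm (a * x))\<^sup>2 - (norm (a * y))\<^sup>2) / 2"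
    by (rule dot_norm)
  also have "\<dots> = (norm a)\<^sup>2 * (((norm (x + y))\<^sup>2 - (norm x)\<^sup>2 - (norm y)\<^sup>2) / 2)"
    by (simp add: norm_mult power_mult_distrib right_diff_distrib flip: distrib_left)
  finally show ?thesis by (simp add: dot_norm[of x y])
qed

text \<open>
  Multiplying both arguments by \<open>a\<close> scales the real inner product by \<open>(norm a)\<^sup>2\<close>, so for
  \<open>a \<noteq> 0\<close> the adjoint of multiplication by \<open>a\<close> is multiplication by \<open>(norm a)\<^sup>2 / a\<close>, which is the conjugate of \<open>a\<close>.
\<close>

lemma inner_mult_left_adjoint: "inner x (a * y) = inner (conjugate a * x) (y::'a::real_or_complex)"
proof (cases "a = 0")
  case False
  have "conjugate a = inverse a * (a * conjugate a)"
    using False by (simp flip: mult.assoc)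
  then have "conjugate a = (norm a)\<^sup>2 *\<^sub>R inverse a"
    by (simp add: mult_conjugate)
  moreover have "inner x (a * y) = inner (a * (inverse a * x)) (a * y)"
    using False by (simp flip: mult.assoc)
  ultimately show ?thesis by (simp add: inner_mult_mult)
qed simp

lemma inner_conjugate_conjugate: "inner (conjugate x) (conjugate y) = inner x (y::'a::real_or_complex)"
proof -
  have "norm (conjugate x + conjugate y) = norm (x + y)"
    by (simp flip: conjugate_add)
  then show ?thesis by (simp add: dot_norm)
qed

lemma conj_transpose_nth [simp]: "conj_transpose A $ i $ j = conjugate (A $ j $ i)"
  by (simp add: conj_transpose_def)

lemma conj_transpose_conj_transpose [simp]: "conj_transpose (conj_transpose A) = A"
  by (simp add: vec_eq_iff conjugate_conjugate)

lemma conj_transpose_mult: "conj_transpose (A ** B) = conj_transpose B ** conj_transpose A"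
  by (simp add: vec_eq_iff matrix_matrix_mult_def conjugate_sum conjugate_mult mult.commute)

lemma conj_transpose_mat_1 [simp]: "conj_transpose (mat 1) = (mat 1 :: 'a::real_or_complex^'n^'n)"
  by (simp add: vec_eq_iff mat_def)

lemma inner_matrix_mult_left:
  fixes A :: "'a::real_or_complex^'n^'m" and B :: "'a^'k^'m"
  shows "inner A (B ** C) = inner (conj_transpose B ** A) C"
proof -
  have "inner A (B ** C) =
      (\<Sum>i\<in>UNIV. \<Sum>j\<in>UNIV. \<Sum>k\<in>UNIV. inner (conjugate (B $ i $ k) * A $ i $ j) (C $ k $ j))"
    by (simp add: inner_vec_def matrix_matrix_mult_def inner_sum_right inner_mult_left_adjoint)
  also have "\<dots> =
      (\<Sum>k\<in>UNIV. \<Sum>j\<in>UNIV. \<Sum>i\<in>UNIV. inner (conjugate (B $ i $ k) * A $ i $ j) (C $ k $ j))"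
    by (subst sum.swap, subst (2) sum.swap, subst sum.swap) (rule refl)
  also have "\<dots> = inner (conj_transpose B ** A) C"
    by (simp add: inner_vec_def matrix_matrix_mult_def inner_sum_left)
  finally show ?thesis .
qed

lemma inner_conj_transpose: "inner (conj_transpose A) (conj_transpose B) = inner A B"
  unfolding inner_vec_def conj_transpose_nth inner_conjugate_conjugate by (rule sum.swap)

lemma inner_matrix_mult_right:
  fixes A :: "'a::real_or_complex^'n^'m" and B :: "'a^'k^'m"
  shows "inner A (B ** C) = inner (A ** conj_transpose C) B"
proof -
  have "inner A (B ** C) = inner (conj_transpose A) (conj_transpose C ** conj_transpose B)"
    unfolding conj_transpose_mult[symmetric] by (rule inner_conj_transpose[symmetric])
  also have "\<dots> = inner (conj_transpose (A ** conj_transpose C)) (conj_transpose B)"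
    unfolding inner_matrix_mult_left conj_transpose_mult ..
  also have "\<dots> = inner (A ** conj_transpose C) B"
    by (rule inner_conj_transpose)
  finally show ?thesis .
qed

section \<open>Unitary matrices\<close>

lemma unitary_matrixI: "conj_transpose U ** U = mat 1 \<Longrightarrow> unitary_matrix U"
  unfolding unitary_matrix_def using matrix_left_right_inverse by blast

lemma unitary_matrix_conj_transpose: "unitary_matrix U \<Longrightarrow> unitary_matrix (conj_transpose U)"
  by (simp add: unitary_matrix_def)

lemma unitary_matrix_mat_1: "unitary_matrix (mat 1)"
  by (simp add: unitary_matrix_def)

lemma unitary_cancel:
  assumes "unitary_matrix U"
  shows "conj_transpose U ** (U ** A) = A" "U ** (conj_transpose U ** A) = A"
    "(B ** U) ** conj_transpose U = B" "(B ** conj_transpose U) ** U = B"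
proof -
  have U: "conj_transpose U ** U = mat 1" "U ** conj_transpose U = mat 1"
    using assms by (simp_all add: unitary_matrix_def)
  show "conj_transpose U ** (U ** A) = A" "U ** (conj_transpose U ** A) = A"
    by (simp_all only: matrix_mul_assoc U matrix_mul_lid)
  show "(B ** U) ** conj_transpose U = B" "(B ** conj_transpose U) ** U = B"
    by (simp_all only: matrix_mul_assoc[symmetric] U matrix_mul_rid)
qed

lemma unitary_matrix_mult:
  assumes "unitary_matrix U" and "unitary_matrix V"
  shows "unitary_matrix (U ** V)"
proof (rule unitary_matrixI)
  have "conj_transpose (U ** V) ** (U ** V) = conj_transpose V ** (conj_transpose U ** (U ** V))"
    by (simp only: conj_transpose_mult matrix_mul_assoc)
  then show "conj_transpose (U ** V) ** (U ** V) = mat 1"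
    using assms(2) by (simp add: unitary_cancel[OF assms(1)] unitary_matrix_def)
qed

lemma tendsto_matrix_mult:
  fixes A :: "_ \<Rightarrow> 'a::real_or_complex^'n^'m" and B :: "_ \<Rightarrow> 'a^'k^'n"
  assumes "(A \<longlongrightarrow> a) F" and "(B \<longlongrightarrow> b) F"
  shows "((\<lambda>x. A x ** B x) \<longlongrightarrow> a ** b) F"
  unfolding matrix_matrix_mult_def
  by (intro vec_tendstoI) (auto intro!: tendsto_intros assms)

lemma tendsto_conj_transpose:
  fixes A :: "_ \<Rightarrow> 'a::real_or_complex^'n^'m"
  assumes "(A \<longlongrightarrow> a) F"
  shows "((\<lambda>x. conj_transpose (A x)) \<longlongrightarrow> conj_transpose a) F"
  unfolding conj_transpose_def
  by (intro vec_tendstoI) (auto intro!: tendsto_intros assms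
      bounded_linear.tendsto[OF bounded_linear_conjugate])

text \<open>
  Unitary matrices have the norm of the identity, since
  \<open>\<langle>U, U\<rangle> = \<langle>U\<^sup>* U, 1\<rangle>\<close>, and they are cut out by a continuous equation.
\<close>

lemma compact_unitary_matrices: "compact {U :: 'a::real_or_complex^'n^'n. unitary_matrix U}"
proof -
  have "norm U = norm (mat 1 :: 'a^'n^'n)" if "unitary_matrix U" for U :: "'a^'n^'n"
    using that inner_matrix_mult_left[of U U "mat 1"]
    by (simp add: norm_eq_sqrt_inner unitary_matrix_def)
  then have "bounded {U :: 'a^'n^'n. unitary_matrix U}"
    by (auto simp: bounded_iff)
  moreover have "closed {U :: 'a^'n^'n. unitary_matrix U}"
    unfolding closed_sequential_limits unitary_matrix_def mem_Collect_eq
  proof (intro allI impI, elim conjE)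
    fix f :: "nat \<Rightarrow> 'a^'n^'n" and U
    assume u: "\<forall>n. conj_transpose (f n) ** f n = mat 1 \<and> f n ** conj_transpose (f n) = mat 1"
      and lim: "f \<longlonglongrightarrow> U"
    have "(\<lambda>n. conj_transpose (f n) ** f n) \<longlonglongrightarrow> conj_transpose U ** U"
      by (intro tendsto_matrix_mult tendsto_conj_transpose lim)
    then have "conj_transpose U ** U = mat 1"
      using u by (simp add: LIMSEQ_const_iff)
    then show "conj_transpose U ** U = mat 1 \<and> U ** conj_transpose U = mat 1"
      using matrix_left_right_inverse by blast
  qed
  ultimately show ?thesis by (simp add: compact_eq_bounded_closed)
qed

text \<open>
  A one-parameter group of unitary matrices acting in the coordinate plane of \<open>p\<close> and \<open>q\<close>; the phase
  \<open>a\<close> selects the direction in which the group leaves the identity.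
\<close>

definition plane_rotation :: "'n \<Rightarrow> 'n \<Rightarrow> 'a \<Rightarrow> real \<Rightarrow> 'a::real_or_complex^'n^'n" where
  "plane_rotation p q a t = (\<chi> i j.
    if i = p then
      (if j = p then of_real (cos t) else if j = q then - (of_real (sin t) * a) else 0)
    else if i = q then
      (if j = p then of_real (sin t) * conjugate a else if j = q then of_real (cos t) else 0)
    else if i = j then 1 else 0)"

lemma unitary_plane_rotation:
  fixes a :: "'a::real_or_complex" and p q :: "'n::finite"
  assumes "p \<noteq> q" and a: "norm a = 1"
  shows "unitary_matrix (plane_rotation p q a t)"
proof (rule unitary_matrixI)
  let ?W = "plane_rotation p q a t"
  have aa: "a * conjugate a = 1" "conjugate a * a = 1"
    using mult_conjugate[of a] a by (simp_all add: mult.commute)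
  have cs: "of_real (cos t) * of_real (cos t) + of_real (sin t) * of_real (sin t) = (1::'a)"
    by (metis of_real_1 of_real_add of_real_mult power2_eq_square sin_cos_squared_add2)
  have aa': "conjugate a * (a * z) = z" "a * (conjugate a * z) = z" for z
    using aa by (simp_all flip: mult.assoc)
  have split: "sum f UNIV = f p + (f q + sum f (UNIV - {p, q}))" for f :: "'n \<Rightarrow> 'a"
  proof -
    have "sum f UNIV = sum f {p,q} + sum f (UNIV - {p,q})"
      by (metis finite subset_UNIV sum.subset_diff add.commute)
    with \<open>p \<noteq> q\<close> show ?thesis by simp
  qed
  have rest: "(\<Sum>k\<in>UNIV - {p,q}. conjugate (?W $ k $ i) * ?W $ k $ j) =
      (if i = j \<and> i \<noteq> p \<and> i \<noteq> q then 1 else 0)" for i j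
  proof -
    have "(\<Sum>k\<in>UNIV - {p,q}. conjugate (?W $ k $ i) * ?W $ k $ j) =
        (\<Sum>k\<in>UNIV - {p,q}. if k = i then (if i = j then 1 else 0) else 0)"
      by (rule sum.cong) (auto simp: plane_rotation_def)
    also have "\<dots> = (if i = j \<and> i \<noteq> p \<and> i \<noteq> q then 1 else 0)"
      by simp
    finally show ?thesis .
  qed
  show "conj_transpose ?W ** ?W = mat 1"
    unfolding vec_eq_iff
  proof (intro allI)
    fix i j
    have "(conj_transpose ?W ** ?W) $ i $ j =
      conjugate (?W $ p $ i) * ?W $ p $ j + (conjugate (?W $ q $ i) * ?W $ q $ j +
        (if i = j \<and> i \<noteq> p \<and> i \<noteq> q then 1 else 0))"
      by (simp add: matrix_matrix_mult_def split rest)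
    also have "\<dots> = mat 1 $ i $ j"
      using \<open>p \<noteq> q\<close> aa cs
      by (auto simp: plane_rotation_def mat_def conjugate_mult conjugate_conjugate algebra_simps aa')
    finally show "(conj_transpose ?W ** ?W) $ i $ j = mat 1 $ i $ j" .
  qed
qed


text \<open>
  Real entries \<open>\<plusminus>1\<close> give the signed permutation matrices; unimodular entries together with the
  identity permutation give the diagonal unitary matrices.
\<close>

definition monomial_matrix :: "('n \<Rightarrow> 'a) \<Rightarrow> ('n \<Rightarrow> 'n) \<Rightarrow> 'a::real_or_complex^'n^'n" where
  "monomial_matrix e \<pi> = (\<chi> i j. if j = \<pi> i then e i else 0)"

lemma unitary_monomial_matrix:
  fixes e :: "'n::finite \<Rightarrow> 'a::real_or_complex"
  assumes "inj \<pi>" and e: "\<And>i. norm (e i) = 1"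
  shows "unitary_matrix (monomial_matrix e \<pi>)"
proof -
  have ee: "e i * conjugate (e i) = 1" for i
    using mult_conjugate[of "e i"] e by simp
  have "(monomial_matrix e \<pi> ** conj_transpose (monomial_matrix e \<pi>)) $ i $ j = mat 1 $ i $ j" for i j
  proof -
    have "(monomial_matrix e \<pi> ** conj_transpose (monomial_matrix e \<pi>)) $ i $ j =
       (\<Sum>k\<in>UNIV. if k = \<pi> i then e i * conjugate (if \<pi> i = \<pi> j then e j else 0) else 0)"
      unfolding monomial_matrix_def matrix_matrix_mult_def conj_transpose_nth vec_lambda_beta
      by (rule sum.cong) auto
    also have "\<dots> = mat 1 $ i $ j"
      using ee by (simp add: mat_def inj_eq[OF \<open>inj \<pi>\<close>])
    finally show ?thesis .
  qed
  then have "monomial_matrix e \<pi> ** conj_transpose (monomial_matrix e \<pi>) = mat 1"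
    by (simp add: vec_eq_iff)
  then show ?thesis
    unfolding unitary_matrix_def using matrix_left_right_inverse by blast
qed

lemma monomial_matrix_vector_mult: "monomial_matrix e \<pi> *v y = (\<chi> i. e i * y $ \<pi> i)"
proof -
  have "(\<Sum>j\<in>UNIV. monomial_matrix e \<pi> $ i $ j * y $ j) =
      (\<Sum>j\<in>UNIV. if j = \<pi> i then e i * y $ \<pi> i else 0)" for i
    unfolding monomial_matrix_def vec_lambda_beta by (rule sum.cong) auto
  then show ?thesis by (simp add: vec_eq_iff matrix_vector_mult_def)
qed

lemma monomial_matrix_mult_nth: "(monomial_matrix e \<pi> ** B) $ i $ j = e i * B $ \<pi> i $ j"
proof -
  have "(\<Sum>k\<in>UNIV. monomial_matrix e \<pi> $ i $ k * B $ k $ j) =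
      (\<Sum>k\<in>UNIV. if k = \<pi> i then e i * B $ \<pi> i $ j else 0)"
    unfolding monomial_matrix_def vec_lambda_beta by (rule sum.cong) auto
  then show ?thesis by (simp add: matrix_matrix_mult_def)
qed

section \<open>Existence of singular value decompositions\<close>

definition single_entry_matrix :: "'n \<Rightarrow> 'n \<Rightarrow> 'a \<Rightarrow> 'a::real_or_complex^'n^'n" where
  "single_entry_matrix p q z = (\<chi> i j. if i = p \<and> j = q then z else 0)"

lemma inner_single_entry_matrix:
  fixes M :: "'a::real_or_complex^'n^'n"
  shows "inner M (single_entry_matrix p q z) = inner (M $ p $ q) z"
proof -
  have "inner M (single_entry_matrix p q z) = 
      (\<Sum>i\<in>UNIV. \<Sum>j\<in>UNIV. if j = q then (if i = p then inner (M $ p $ q) z else 0) else 0)"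
    unfolding inner_vec_def single_entry_matrix_def vec_lambda_beta
    by (intro sum.cong refl) auto
  then show ?thesis by simp
qed

text \<open>
  The first-order condition: along every rotation through the identity the function
  \<open>W \<mapsto> \<langle>M, W\<rangle>\<close> has a maximum at the identity, so its derivative vanishes. For the rotation
  with phase \<open>a\<close> that derivative is the inner product of \<open>a\<close> with the defect
  \<open>conjugate (M $ q $ p) - M $ p $ q\<close>; the phase pointing along the defect shows that it is zero.
\<close>

lemma hermitian_if_inner_maximal:
  fixes M :: "'a::real_or_complex^'n^'n"
  assumes max: "\<And>W. unitary_matrix W \<Longrightarrow> inner M W \<le> inner M (mat 1)" and "p \<noteq> q"
  shows "M $ p $ q = conjugate (M $ q $ p)"
proof (rule ccontr)
  assume ne: "M $ p $ q \<noteq> conjugate (M $ q $ p)"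
  define d where "d = conjugate (M $ q $ p) - M $ p $ q"
  define a where "a = d /\<^sub>R norm d"
  have "d \<noteq> 0" using ne by (simp add: d_def)
  then have a: "norm a = 1" by (simp add: a_def)
  define E :: "'a^'n^'n" where "E = single_entry_matrix p p 1 + single_entry_matrix q q 1"
  define F where "F = single_entry_matrix q p (conjugate a) - single_entry_matrix p q a"
  have rotation: "plane_rotation p q a t = mat 1 + (cos t - 1) *\<^sub>R E + sin t *\<^sub>R F" for t
    unfolding vec_eq_iff using \<open>p \<noteq> q\<close>
    by (auto simp: plane_rotation_def E_def F_def single_entry_matrix_def mat_def
        scaleR_conv_of_real[where 'a = 'a])
  have le: "(cos t - 1) * inner M E + sin t * inner M F \<le> 0" for t
    using max[OF unitary_plane_rotation[OF \<open>p \<noteq> q\<close> a, of t]]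
    by (simp add: rotation inner_add_right)
  have "((\<lambda>t. (cos t - 1) * inner M E + sin t * inner M F) has_real_derivative inner M F) (at 0)"
    by (auto intro!: derivative_eq_intros)
  then have "inner M F = 0"
    by (rule DERIV_local_max[of _ _ _ 1]) (use le in auto)
  moreover have "inner M F = inner d a"
    using inner_conjugate_conjugate[of "M $ q $ p" "conjugate a"]
    by (simp add: F_def d_def inner_diff_right inner_diff_left inner_single_entry_matrix conjugate_conjugate)
  ultimately show False
    using \<open>d \<noteq> 0\<close> by (simp add: a_def)
qed

text \<open>
  Replacing the \<open>p\<close>-th diagonal entry of the identity by the phase of \<open>M $ p $ p\<close> would raise the
  inner product with \<open>M\<close> unless that phase is \<open>1\<close>: maximality is the equality case of
  Cauchy-Schwarz.
\<close>

lemma real_diagonal_if_inner_maximal: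
  fixes M :: "'a::real_or_complex^'n^'n"
  assumes max: "\<And>W. unitary_matrix W \<Longrightarrow> inner M W \<le> inner M (mat 1)"
  shows "M $ p $ p = of_real (norm (M $ p $ p))"
proof (cases "M $ p $ p = 0")
  case False
  define z where "z = M $ p $ p"
  define w where "w = z /\<^sub>R norm z"
  have "z \<noteq> 0" using False by (simp add: z_def)
  have "unitary_matrix (monomial_matrix (\<lambda>i. if i = p then w else 1) (\<lambda>i. i))"
    by (rule unitary_monomial_matrix) (use \<open>z \<noteq> 0\<close> in \<open>auto simp: w_def\<close>)
  moreover have "monomial_matrix (\<lambda>i. if i = p then w else 1) (\<lambda>i. i) = mat 1 + single_entry_matrix p p (w - 1)"
    by (auto simp: vec_eq_iff monomial_matrix_def single_entry_matrix_def mat_def)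
  ultimately have "inner z (w - 1) \<le> 0"
    using max by (fastforce simp: inner_add_right inner_single_entry_matrix z_def)
  moreover have "inner z w = norm z"
    using \<open>z \<noteq> 0\<close> by (simp add: w_def dot_square_norm power2_eq_square)
  ultimately have "norm z * norm (1::'a) \<le> inner z 1"
    by (simp add: inner_diff_right)
  then have "inner z 1 = norm z * norm (1::'a)"
    using norm_cauchy_schwarz[of z 1] by simp
  then have "norm z *\<^sub>R 1 = norm (1::'a) *\<^sub>R z"
    by (subst (asm) norm_cauchy_schwarz_eq)
  then show ?thesis by (simp add: z_def of_real_def)
qed simp

lemma index_rank_less: "i < j \<Longrightarrow> index_rank i < index_rank (j::'i::{finite,linorder})"
  unfolding index_rank_def by (rule psubset_card_mono) auto

lemma index_rank_mono: "i \<le> j \<Longrightarrow> index_rank i \<le> index_rank (j::'i::{finite,linorder})"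
  by (auto simp: le_less index_rank_less)

lemma inj_index_rank: "inj (index_rank :: 'i::{finite,linorder} \<Rightarrow> nat)"
  by (rule linorder_injI) (use index_rank_less in fastforce)

lemma range_index_rank: "range (index_rank :: 'i::{finite,linorder} \<Rightarrow> nat) = {..<CARD('i)}"
proof (rule card_subset_eq)
  show "range (index_rank :: 'i \<Rightarrow> nat) \<subseteq> {..<CARD('i)}"
    unfolding index_rank_def by (auto intro!: psubset_card_mono)
qed (simp_all add: card_image inj_index_rank)

text \<open>
  The column in which \<open>rect_diag\<close> puts the entry of row \<open>i\<close>. There is exactly one if there are at
  least as many columns as rows.
\<close>

definition diag_col :: "'m::{finite,linorder} \<Rightarrow> 'n::{finite,linorder}" where
  "diag_col i = (SOME j. index_rank j = index_rank i)"

context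
  assumes card_le: "CARD('m::{finite,linorder}) \<le> CARD('n::{finite,linorder})"
begin

lemma index_rank_diag_col: "index_rank (diag_col i :: 'n) = index_rank (i :: 'm)"
proof -
  have "index_rank i \<in> range (index_rank :: 'n \<Rightarrow> nat)"
    using card_le rangeI[of index_rank i] by (auto simp: range_index_rank)
  then have "\<exists>j::'n. index_rank j = index_rank i" by (metis imageE)
  then show ?thesis unfolding diag_col_def by (rule someI_ex)
qed

lemma index_rank_eq_iff: "index_rank i = index_rank (j :: 'n) \<longleftrightarrow> j = diag_col (i :: 'm)"
  by (metis index_rank_diag_col inj_eq inj_index_rank)

lemma inj_diag_col: "inj (diag_col :: 'm \<Rightarrow> 'n)"
  by (metis index_rank_diag_col inj_def inj_index_rank)

lemma diag_col_eq_iff [simp]: "diag_col i = (diag_col k :: 'n) \<longleftrightarrow> i = (k::'m)"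
  using inj_diag_col by (rule inj_eq)

lemma rect_diag_nth:
  "(rect_diag x :: 'a::real_or_complex^'n::_^'m::_) $ i $ j =
    (if j = diag_col i then of_real (x $ i) else 0)"
  by (simp add: rect_diag_def index_rank_eq_iff)

lemma mult_rect_diag_nth:
  fixes A :: "'a::real_or_complex^'m::_^'k"
  shows "(A ** (rect_diag x :: 'a^'n::_^'m::_)) $ p $ diag_col q = A $ p $ q * of_real (x $ q)"
    and "j \<notin> range (diag_col :: 'm \<Rightarrow> 'n) \<Longrightarrow> (A ** (rect_diag x :: 'a^'n::_^'m::_)) $ p $ j = 0"
proof -
  have "(A ** (rect_diag x :: 'a^'n::_^'m::_)) $ p $ diag_col q =
      (\<Sum>k\<in>UNIV. if k = q then A $ p $ q * of_real (x $ q) else 0)"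
    unfolding matrix_matrix_mult_def vec_lambda_beta rect_diag_nth by (rule sum.cong) auto
  then show "(A ** (rect_diag x :: 'a^'n::_^'m::_)) $ p $ diag_col q = A $ p $ q * of_real (x $ q)"
    by simp
qed (auto simp: matrix_matrix_mult_def rect_diag_nth intro!: sum.neutral)

lemma rect_diag_mult_nth:
  fixes A :: "'a::real_or_complex^'k^'n::_"
  shows "((rect_diag x :: 'a^'n::_^'m::_) ** A) $ p $ q = of_real (x $ p) * A $ diag_col p $ q"
proof -
  have "((rect_diag x :: 'a^'n::_^'m::_) ** A) $ p $ q =
      (\<Sum>k\<in>(UNIV :: 'n set). if k = diag_col p then of_real (x $ p) * A $ diag_col p $ q else 0)"
    unfolding matrix_matrix_mult_def vec_lambda_beta rect_diag_nth by (rule sum.cong) auto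
  then show ?thesis by simp
qed

lemma mult_conj_transpose_rect_diag_nth:
  fixes A :: "'a::real_or_complex^'n::_^'k"
  shows "(A ** conj_transpose (rect_diag x :: 'a^'n::_^'m::_)) $ p $ q = A $ p $ diag_col q * of_real (x $ q)"
proof -
  have "(A ** conj_transpose (rect_diag x :: 'a^'n::_^'m::_)) $ p $ q =
      (\<Sum>k\<in>(UNIV :: 'n set). if k = diag_col q then A $ p $ diag_col q * of_real (x $ q) else 0)"
    unfolding matrix_matrix_mult_def vec_lambda_beta rect_diag_nth conj_transpose_nth
    by (rule sum.cong) auto
  then show ?thesis by simp
qed

lemma conj_transpose_rect_diag_mult_nth:
  fixes A :: "'a::real_or_complex^'k^'m::_"
  shows "(conj_transpose (rect_diag x :: 'a^'n::_^'m::_) ** A) $ diag_col p $ q = of_real (x $ p) * A $ p $ q"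
    and "j \<notin> range (diag_col :: 'm \<Rightarrow> 'n) \<Longrightarrow> (conj_transpose (rect_diag x :: 'a^'n::_^'m::_) ** A) $ j $ q = 0"
proof -
  have "(conj_transpose (rect_diag x :: 'a^'n::_^'m::_) ** A) $ diag_col p $ q =
      (\<Sum>k\<in>UNIV. if k = p then of_real (x $ p) * A $ p $ q else 0)"
    unfolding matrix_matrix_mult_def vec_lambda_beta rect_diag_nth conj_transpose_nth
    by (rule sum.cong) auto
  then show "(conj_transpose (rect_diag x :: 'a^'n::_^'m::_) ** A) $ diag_col p $ q = of_real (x $ p) * A $ p $ q"
    by simp
qed (auto simp: matrix_matrix_mult_def rect_diag_nth intro!: sum.neutral)

text \<open>
  Let \<open>C = S(c)\<close>. By maximality both \<open>A C\<^sup>*\<close> and \<open>C\<^sup>* A\<close> are Hermitian. Identify the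
  diagonal columns with the rows; comparing the entries at \<open>(p, q)\<close> gives
  \<open>A\<^sub>p\<^sub>q c\<^sub>q\<^sup>2 = A\<^sub>p\<^sub>q c\<^sub>p\<^sup>2\<close>, which kills the off-diagonal entries because the
  weights are distinct and positive. The columns beyond the diagonal vanish because the corresponding
  rows of \<open>C\<^sup>* A\<close> do, and the diagonal is real because that of \<open>A C\<^sup>*\<close> is.
\<close>

lemma rect_diag_if_inner_maximal:
  fixes A :: "'a::real_or_complex^'n::_^'m::_" and c :: "real^'m::_"
  assumes c: "\<And>i. c $ i > 0" "inj (\<lambda>i. c $ i)"
    and left: "\<And>W. unitary_matrix W \<Longrightarrow> inner A (W ** rect_diag c) \<le> inner A (rect_diag c)"
    and right: "\<And>W. unitary_matrix W \<Longrightarrow> inner A (rect_diag c ** W) \<le> inner A (rect_diag c)"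
  shows "\<exists>x. A = rect_diag x"
proof -
  let ?C = "rect_diag c :: 'a^'n::_^'m::_"
  define L where "L = A ** conj_transpose ?C"
  define R where "R = conj_transpose ?C ** A"
  have maxL: "inner L W \<le> inner L (mat 1)" if "unitary_matrix W" for W
    using left[OF that] inner_matrix_mult_right[of A W ?C] inner_matrix_mult_right[of A "mat 1" ?C]
    by (simp add: L_def)
  have maxR: "inner R W \<le> inner R (mat 1)" if "unitary_matrix W" for W
    using right[OF that] inner_matrix_mult_left[of A ?C W] inner_matrix_mult_left[of A ?C "mat 1"]
    by (simp add: R_def)
  have Lnth: "L $ p $ q = A $ p $ diag_col q * of_real (c $ q)" for p q
    unfolding L_def by (rule mult_conj_transpose_rect_diag_nth)
  have Rnth: "R $ diag_col p $ j = of_real (c $ p) * A $ p $ j" for p j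
    unfolding R_def by (rule conj_transpose_rect_diag_mult_nth)
  have R0: "R $ j $ k = 0" if "j \<notin> range (diag_col :: 'm \<Rightarrow> 'n)" for j k
    unfolding R_def using that by (rule conj_transpose_rect_diag_mult_nth)
  have c0: "of_real (c $ i) \<noteq> (0::'a)" for i
    using c(1)[of i] by simp
  have "\<exists>r. A $ p $ diag_col p = of_real r" for p
  proof
    have "A $ p $ diag_col p * of_real (c $ p) = of_real (norm (L $ p $ p))"
      using real_diagonal_if_inner_maximal[OF maxL, of p] by (simp add: Lnth)
    then show "A $ p $ diag_col p = of_real (norm (L $ p $ p) / c $ p)"
      using c0[of p] by (simp add: field_simps)
  qed
  then obtain x where x: "\<And>p. A $ p $ diag_col p = of_real (x p)" by metis
  have outside: "A $ p $ j = 0" if "j \<notin> range (diag_col :: 'm \<Rightarrow> 'n)" for p j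
  proof -
    have "R $ diag_col p $ j = conjugate (R $ j $ diag_col p)"
      using that by (intro hermitian_if_inner_maximal[OF maxR]) auto
    with that c(1)[of p] show ?thesis by (auto simp: R0 Rnth)
  qed
  have inside: "A $ p $ diag_col q = 0" if "p \<noteq> q" for p q
  proof (rule ccontr)
    assume ne: "A $ p $ diag_col q \<noteq> 0"
    have l: "A $ p $ diag_col q * of_real (c $ q) = conjugate (A $ q $ diag_col p) * of_real (c $ p)"
      using hermitian_if_inner_maximal[OF maxL that] by (simp add: Lnth conjugate_mult)
    have r: "of_real (c $ p) * A $ p $ diag_col q = of_real (c $ q) * conjugate (A $ q $ diag_col p)"
      using hermitian_if_inner_maximal[OF maxR, of "diag_col p" "diag_col q"] that
      by (simp add: Rnth conjugate_mult)
    have "A $ p $ diag_col q * of_real (c $ q) * of_real (c $ q) =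
        A $ p $ diag_col q * of_real (c $ p) * of_real (c $ p)"
      using l r by (simp add: ac_simps)
    then have "of_real (c $ q * c $ q) = (of_real (c $ p * c $ p) :: 'a)"
      using ne by simp
    then have "(c $ q)\<^sup>2 = (c $ p)\<^sup>2"
      unfolding of_real_eq_iff by (simp add: power2_eq_square)
    then have "c $ q = c $ p"
      using c(1) by (simp add: less_imp_le)
    then show False
      using that c(2) by (simp add: inj_eq)
  qed
  have "A = rect_diag (\<chi> i. x i)"
    unfolding vec_eq_iff
  proof (intro allI)
    fix p j show "A $ p $ j = rect_diag (\<chi> i. x i) $ p $ j"
      by (cases "j \<in> range (diag_col :: 'm \<Rightarrow> 'n)") (auto simp: rect_diag_nth x outside inside)
  qed
  then show ?thesis ..
qed

text \<open>
  A maximizer \<open>(U, V)\<close> of \<open>\<langle>Z, U S(c) V\<^sup>*\<rangle>\<close> exists by compactness. Then \<open>A = U\<^sup>* Z V\<close> has maximal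
  inner product with \<open>S(c)\<close> in the sense of the preceding lemma. Sorting the diagonal entries and
  making them nonnegative is left to signed permutations.
\<close>

lemma svd_exists:
  fixes Z :: "'a::real_or_complex^'n::_^'m::_"
  shows "\<exists>U V x. unitary_matrix U \<and> unitary_matrix V \<and> Z = U ** rect_diag x ** conj_transpose V"
proof -
  \<comment> \<open>any distinct positive weights would do; ranks start at \<open>0\<close>, hence the successor\<close>
  define c :: "real^'m::_" where "c = (\<chi> i. real (Suc (index_rank i)))"
  let ?C = "rect_diag c :: 'a^'n::_^'m::_"
  let ?S = "{U :: 'a^'m::_^'m::_. unitary_matrix U} \<times> {V :: 'a^'n::_^'n::_. unitary_matrix V}"
  let ?f = "\<lambda>(U, V). inner Z (U ** ?C ** conj_transpose V)"
  have cont: "continuous_on ?S ?f"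
    unfolding continuous_on_def case_prod_beta
    by (intro ballI tendsto_intros tendsto_matrix_mult tendsto_conj_transpose)
  have "(mat 1, mat 1) \<in> ?S"
    by (simp add: unitary_matrix_mat_1)
  then have "?S \<noteq> {}" by (rule ex_in_conv[THEN iffD1, OF exI])
  from continuous_attains_sup[OF compact_Times[OF compact_unitary_matrices compact_unitary_matrices] this cont]
  obtain P where P: "P \<in> ?S" "\<And>P'. P' \<in> ?S \<Longrightarrow> ?f P' \<le> ?f P"
    by blast
  obtain U V where UV: "P = (U, V)" by (cases P)
  have U: "unitary_matrix U" and V: "unitary_matrix V"
    using P(1) by (simp_all add: UV)
  have max: "inner Z (U' ** ?C ** conj_transpose V') \<le> inner Z (U ** ?C ** conj_transpose V)"
    if "unitary_matrix U'" "unitary_matrix V'" for U' V'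
    using P(2)[of "(U', V')"] that by (simp add: UV)
  define A where "A = conj_transpose U ** Z ** V"
  have inner_A: "inner A B = inner Z (U ** B ** conj_transpose V)" for B
    unfolding A_def
    by (simp only: matrix_mul_assoc[of U B, symmetric] inner_matrix_mult_left[of Z U]
        inner_matrix_mult_right[of _ B "conj_transpose V"] conj_transpose_conj_transpose)
  have "\<exists>x. A = rect_diag x"
  proof (rule rect_diag_if_inner_maximal)
    show "c $ i > 0" for i by (simp add: c_def)
    show "inj (\<lambda>i. c $ i)" using inj_index_rank by (auto simp: c_def inj_def)
    fix W :: "'a^'m::_^'m::_" assume "unitary_matrix W"
    with max[of "U ** W" V] show "inner A (W ** ?C) \<le> inner A ?C"
      by (simp add: inner_A U V unitary_matrix_mult matrix_mul_assoc)
  next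
    fix W :: "'a^'n::_^'n::_" assume "unitary_matrix W"
    with max[of U "V ** conj_transpose W"] show "inner A (?C ** W) \<le> inner A ?C"
      by (simp add: inner_A U V unitary_matrix_mult unitary_matrix_conj_transpose matrix_mul_assoc
          conj_transpose_mult)
  qed
  then obtain x where "A = rect_diag x" ..
  moreover have "Z = U ** A ** conj_transpose V"
    unfolding A_def by (simp only: matrix_mul_assoc[symmetric] unitary_cancel[OF U]) 
      (simp only: unitary_cancel[OF V] matrix_mul_assoc)
  ultimately show ?thesis using U V by blast
qed

end

section \<open>Signed permutations\<close>

lemma ex_sorting_permutation:
  fixes x :: "real^'m::{finite,linorder}"
  shows "\<exists>\<pi>::'m \<Rightarrow> 'm. inj \<pi> \<and> (\<forall>i j. i \<le> j \<longrightarrow> \<bar>x $ \<pi> j\<bar> \<le> \<bar>x $ \<pi> i\<bar>)"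
proof -
  define ys where "ys = sort_key (\<lambda>i. - \<bar>x $ i\<bar>) (sorted_list_of_set UNIV)"
  have ys: "distinct ys" "length ys = CARD('m)" "sorted (map (\<lambda>i. - \<bar>x $ i\<bar>) ys)"
    by (simp_all add: ys_def)
  have less: "index_rank i < length ys" for i :: 'm
    using range_index_rank ys(2) by auto
  have "inj (\<lambda>i::'m. ys ! index_rank i)"
    using inj_index_rank[where 'i = 'm] less ys(1) by (auto simp: inj_def nth_eq_iff_index_eq)
  moreover have "\<bar>x $ (ys ! index_rank j)\<bar> \<le> \<bar>x $ (ys ! index_rank i)\<bar>" if "i \<le> j" for i j :: 'm
    using sorted_nth_mono[OF ys(3) index_rank_mono[OF that]] less by simp
  ultimately show ?thesis by blast
qed

lemma signed_permutation_monomial_matrix: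
  fixes e :: "'m::finite \<Rightarrow> real"
  assumes "inj \<pi>" and e: "\<And>i. \<bar>e i\<bar> = 1"
  shows "signed_permutation_matrix (monomial_matrix e \<pi>)"
proof -
  have "e i \<noteq> 0" "e i = 1 \<or> e i = -1" for i
    using e[of i] by auto
  moreover have "\<exists>!i. j = \<pi> i" for j
    using \<open>inj \<pi>\<close> by (metis finite_UNIV_inj_surj inj_def surjD finite)
  ultimately show ?thesis
    by (auto simp: signed_permutation_matrix_def monomial_matrix_def)
qed

text \<open>
  The form in which absolute symmetry is used: a coincidence \<open>x\<^sub>i = \<plusminus> x\<^sub>j\<close> means that the signed
  transposition of \<open>i\<close> and \<open>j\<close> fixes \<open>x\<close>, so it fixes \<open>g x\<close> too. For \<open>i = j\<close> and sign \<open>-1\<close> this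
  says that zero entries stay zero.
\<close>

lemma absolutely_symmetric_on_eq_sign:
  fixes g :: "real^'m \<Rightarrow> real^'m"
  assumes g: "absolutely_symmetric_on D g" and "x \<in> D" and d: "\<bar>d\<bar> = 1"
    and x: "x $ i = d * x $ j"
  shows "g x $ i = d * g x $ j"
proof -
  define e where "e k = (if k = i \<or> k = j then d else 1)" for k
  define Q where "Q = monomial_matrix e (Transposition.transpose i j)"
  have dd: "d * (d * z) = z" for z
    using d by (auto simp: abs_if split: if_splits)
  have "signed_permutation_matrix Q"
    unfolding Q_def by (rule signed_permutation_monomial_matrix) (simp_all add: e_def d)
  moreover have "(Q *v x) $ k = x $ k" for k
  proof -
    have "d * x $ i = x $ j"
      by (simp only: x dd)
    with x show ?thesis
      by (cases "k = i"; cases "k = j")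
        (simp_all add: Q_def monomial_matrix_vector_mult e_def transpose_apply_other)
  qed
  then have "Q *v x = x" by (simp add: vec_eq_iff)
  ultimately have "g x = Q *v g x"
    using g \<open>x \<in> D\<close> unfolding absolutely_symmetric_on_def by metis
  then have "g x $ i = (Q *v g x) $ i"
    by (rule arg_cong)
  also have "\<dots> = d * g x $ j"
    by (simp add: Q_def monomial_matrix_vector_mult e_def)
  finally show ?thesis .
qed

text \<open>
  Rows and columns must be permuted together; the column permutation fixes the columns beyond the
  diagonal. The signs are absorbed by the row factor.
\<close>

lemma rect_diag_signed_permutation:
  fixes e :: "'m::{finite,linorder} \<Rightarrow> real"
  assumes card: "CARD('m) \<le> CARD('n::{finite,linorder})"
    and "inj \<pi>" and e: "\<And>i. \<bar>e i\<bar> = 1"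
  obtains P :: "'a::real_or_complex^'m::{finite,linorder}^'m::_" and R :: "'a^'n::{finite,linorder}^'n::_"
  where "unitary_matrix P" and "unitary_matrix R"
    and "\<And>x. rect_diag (monomial_matrix e \<pi> *v x) = P ** rect_diag x ** conj_transpose R"
proof -
  define \<pi>' :: "'n \<Rightarrow> 'n"
    where "\<pi>' j = (if j \<in> range (diag_col :: 'm \<Rightarrow> 'n) then diag_col (\<pi> (inv diag_col j)) else j)"
    for j
  define P :: "'a^'m::_^'m::_" where "P = monomial_matrix (\<lambda>i. of_real (e i)) \<pi>"
  define R :: "'a^'n::_^'n::_" where "R = monomial_matrix (\<lambda>i. 1) \<pi>'"
  note [simp] = diag_col_eq_iff[OF card] inv_f_f[OF inj_diag_col[OF card]] inj_eq[OF \<open>inj \<pi>\<close>]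
  have "inj \<pi>'"
    by (rule injI) (auto simp: \<pi>'_def split: if_splits)
  have P: "unitary_matrix P" and R: "unitary_matrix R"
    unfolding P_def R_def using \<open>inj \<pi>\<close> \<open>inj \<pi>'\<close> e by (auto intro!: unitary_monomial_matrix)
  have "rect_diag (monomial_matrix e \<pi> *v x) ** R = P ** rect_diag x" for x
    by (auto simp: vec_eq_iff rect_diag_mult_nth[OF card] P_def monomial_matrix_mult_nth
        monomial_matrix_vector_mult rect_diag_nth[OF card] R_def) (auto simp: monomial_matrix_def \<pi>'_def)
  then have "rect_diag (monomial_matrix e \<pi> *v x) = P ** rect_diag x ** conj_transpose R" for x
    by (metis unitary_cancel(3)[OF R])
  with P R that show ?thesis by blast
qed

section \<open>Singular values are determined by the matrix\<close>

text \<open>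
  Equal polynomials have the same multiset of roots, so for every threshold \<open>v\<close> equally many squares
  are at least \<open>v\<close> on both sides. By monotonicity the indices where this happens form an initial
  segment, and initial segments of equal size coincide.
\<close>

lemma antimono_nonneg_eq_if_squares_prod_eq:
  fixes r s :: "'m::{finite,linorder} \<Rightarrow> real"
  assumes r: "antimono r" "\<And>i. 0 \<le> r i" and s: "antimono s" "\<And>i. 0 \<le> s i"
    and eq: "\<And>t. (\<Prod>i\<in>UNIV. t - (r i)\<^sup>2) = (\<Prod>i\<in>UNIV. t - (s i)\<^sup>2)"
  shows "r = s"
proof -
  define p where "p f = (\<Prod>i\<in>UNIV. [:- (f i)\<^sup>2, 1:])" for f :: "'m \<Rightarrow> real"
  have "poly (p r) = poly (p s)"
    using eq by (simp add: fun_eq_iff p_def poly_prod)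
  then have "proots (p r) = proots (p s)"
    by (simp add: poly_eq_poly_eq_iff)
  then have roots: "(\<Sum>i\<in>UNIV. {#(r i)\<^sup>2#}) = (\<Sum>i\<in>UNIV. {#(s i)\<^sup>2#})"
    by (simp add: p_def proots_prod)
  have count: "size (filter_mset (\<lambda>u. v \<le> u) (\<Sum>i\<in>A. {#f i#})) = card {i\<in>A. v \<le> f i}"
    if "finite A" for v and f :: "'m \<Rightarrow> real" and A
    using that
  proof induction
    case (insert i A)
    then have "{k \<in> insert i A. v \<le> f k} =
        (if v \<le> f i then insert i {k\<in>A. v \<le> f k}
         else {k\<in>A. v \<le> f k})"
      by auto
    with insert show ?case by simp
  qed simp
  have card: "card {i. v \<le> (r i)\<^sup>2} = card {i. v \<le> (s i)\<^sup>2}" for v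
    using arg_cong[OF roots, of "\<lambda>M. size (filter_mset (\<lambda>u. v \<le> u) M)"] by (simp add: count)
  have segments: "{i. v \<le> (r i)\<^sup>2} = {i. v \<le> (s i)\<^sup>2}" for v
  proof -
    have down: "j \<in> {i. v \<le> (f i)\<^sup>2}"
      if "antimono f" "\<And>i. 0 \<le> f i" "i \<in> {i. v \<le> (f i)\<^sup>2}" "j \<le> i"
      for f :: "'m \<Rightarrow> real" and i j
    proof -
      have "(f i)\<^sup>2 \<le> (f j)\<^sup>2"
        using antimonoD[OF that(1,4)] that(2) by (rule power_mono)
      with that(3) show ?thesis by simp
    qed
    have "{i. v \<le> (r i)\<^sup>2} \<subseteq> {i. v \<le> (s i)\<^sup>2} \<or> {i. v \<le> (s i)\<^sup>2} \<subseteq> {i. v \<le> (r i)\<^sup>2}"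
      using down[OF r] down[OF s] by (meson linear subsetI)
    with card[of v] show ?thesis
      using card_subset_eq finite by metis
  qed
  show "r = s"
  proof
    fix i
    have "(r i)\<^sup>2 \<le> (s i)\<^sup>2" "(s i)\<^sup>2 \<le> (r i)\<^sup>2"
      using segments[of "(r i)\<^sup>2"] segments[of "(s i)\<^sup>2"] by blast+
    then show "r i = s i"
      using power2_le_imp_le r(2) s(2) by (intro antisym) blast+
  qed
qed

lemma matrix_mult_diff_left: "A ** (B - C) = A ** B - A ** (C :: 'a::ring_1^'k^'n)"
  by (simp add: vec_eq_iff matrix_matrix_mult_def right_diff_distrib sum_subtractf)

lemma matrix_mult_diff_right: "(A - B) ** C = A ** C - B ** (C :: 'a::ring_1^'k^'n)"
  by (simp add: vec_eq_iff matrix_matrix_mult_def left_diff_distrib sum_subtractf)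

lemma det_char_svd:
  fixes U :: "'a::real_or_complex^'m::{finite,linorder}^'m::_" and V :: "'a^'n::{finite,linorder}^'n::_"
  assumes card: "CARD('m) \<le> CARD('n)"
    and U: "unitary_matrix U" and V: "unitary_matrix V"
    and Z: "Z = U ** rect_diag s ** conj_transpose V"
  shows "det (mat t - Z ** conj_transpose Z) = (\<Prod>i\<in>UNIV. t - of_real ((s $ i)\<^sup>2))"
proof -
  let ?S = "rect_diag s :: 'a^'n::_^'m::_"
  have "Z ** conj_transpose Z = U ** (?S ** conj_transpose ?S) ** conj_transpose U"
    unfolding Z conj_transpose_mult conj_transpose_conj_transpose
    by (simp only: matrix_mul_assoc[symmetric] unitary_cancel[OF V])
  moreover have "U ** mat t = mat t ** U"
    by (simp add: vec_eq_iff matrix_matrix_mult_def mat_def if_distrib[of "\<lambda>z. _ * z"]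
      if_distrib[of "\<lambda>z. z * _"] mult.commute cong: if_cong)
  ultimately have "mat t - Z ** conj_transpose Z = U ** (mat t - ?S ** conj_transpose ?S) ** conj_transpose U"
    by (simp add: matrix_mult_diff_left matrix_mult_diff_right unitary_cancel[OF U])
  then have "det (mat t - Z ** conj_transpose Z) = det (U ** conj_transpose U) * det (mat t - ?S ** conj_transpose ?S)"
    by (simp add: det_mul)
  also have "\<dots> = det (mat t - ?S ** conj_transpose ?S)"
    using U by (simp add: unitary_matrix_def)
  also have "\<dots> = (\<Prod>i\<in>UNIV. t - of_real ((s $ i)\<^sup>2))"
    by (subst det_diagonal) (auto simp: mat_def mult_conj_transpose_rect_diag_nth[OF card]
       rect_diag_nth[OF card] diag_col_eq_iff[OF card] power2_eq_square)
  finally show ?thesis .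
qed

lemma singular_values_eq:
  fixes U :: "'a::real_or_complex^'m::{finite,linorder}^'m::_" and V :: "'a^'n::{finite,linorder}^'n::_"
  assumes card: "CARD('m) \<le> CARD('n)"
    and U: "unitary_matrix U" and V: "unitary_matrix V"
    and Z: "Z = U ** rect_diag s ** conj_transpose V"
    and s: "\<And>i j. i \<le> j \<Longrightarrow> s $ j \<le> s $ i" "\<And>i. 0 \<le> s $ i"
  shows "singular_values Z = s"
  unfolding singular_values_def
proof (rule the_equality)
  note char = det_char_svd[OF card U V Z]
  show "(\<forall>i j. i \<le> j \<longrightarrow> s $ j \<le> s $ i) \<and> (\<forall>i. 0 \<le> s $ i) \<and>
     (\<forall>t. det (mat t - Z ** conj_transpose Z) = (\<Prod>i\<in>UNIV. t - of_real ((s $ i)\<^sup>2)))"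
    using s char by blast
  fix r :: "real^'m::_"
  assume r: "(\<forall>i j. i \<le> j \<longrightarrow> r $ j \<le> r $ i) \<and> (\<forall>i. 0 \<le> r $ i) \<and>
     (\<forall>t. det (mat t - Z ** conj_transpose Z) = (\<Prod>i\<in>UNIV. t - of_real ((r $ i)\<^sup>2)))"
  have "(\<Prod>i\<in>UNIV. t - (r $ i)\<^sup>2) = (\<Prod>i\<in>UNIV. t - (s $ i)\<^sup>2)" for t
  proof -
    have "(\<Prod>i\<in>UNIV. of_real t - of_real ((r $ i)\<^sup>2)) = (\<Prod>i\<in>UNIV. of_real t - of_real ((s $ i)\<^sup>2) :: 'a)"
      using r char[of "of_real t"] by metis
    then have "of_real (\<Prod>i\<in>UNIV. t - (r $ i)\<^sup>2) = (of_real (\<Prod>i\<in>UNIV. t - (s $ i)\<^sup>2) :: 'a)"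
      by (simp only: of_real_prod of_real_diff)
    then show ?thesis by (simp only: of_real_eq_iff)
  qed
  then have "(\<lambda>i. r $ i) = (\<lambda>i. s $ i)"
    using r s by (intro antimono_nonneg_eq_if_squares_prod_eq) (auto intro!: antimonoI)
  then show "r = s" by (simp add: vec_eq_iff fun_eq_iff)
qed


section \<open>Spectral operators are well defined\<close>

text \<open>
  Together with its adjoint, the hypothesis reads \<open>U\<^sub>p\<^sub>q x\<^sub>q = x\<^sub>p V\<^sub>p\<^sub>q\<close> and
  \<open>V\<^sub>p\<^sub>q x\<^sub>q = x\<^sub>p U\<^sub>p\<^sub>q\<close>, with the diagonal columns identified with the rows. Therefore
  \<open>U\<^sub>p\<^sub>q\<close> and \<open>V\<^sub>p\<^sub>q\<close> vanish unless \<open>x\<^sub>p = \<plusminus> x\<^sub>q\<close>, and for \<open>x\<^sub>q \<noteq> 0\<close> they agree up to that sign;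
  beyond the diagonal columns, row \<open>p\<close> of \<open>V\<close> vanishes if \<open>x\<^sub>p \<noteq> 0\<close>. A vector
  \<open>y\<close> with the same coincidences satisfies the same equations.
\<close>

lemma rect_diag_commute:
  fixes U :: "'a::real_or_complex^'m::{finite,linorder}^'m::_" and V :: "'a^'n::{finite,linorder}^'n::_"
    and x y :: "real^'m::_"
  assumes card: "CARD('m) \<le> CARD('n)"
    and U: "unitary_matrix U" and V: "unitary_matrix V"
    and y: "\<And>i j d. \<bar>d\<bar> = 1 \<Longrightarrow> x $ i = d * x $ j \<Longrightarrow> y $ i = d * y $ j"
    and comm: "U ** rect_diag x = rect_diag x ** V"
  shows "U ** rect_diag y = rect_diag y ** V"
proof -
  let ?X = "rect_diag x :: 'a^'n::_^'m::_"
  have zero: "y $ i = 0" if "x $ i = 0" for i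
    using y[of "-1" i i] that by simp
  have "conj_transpose ?X ** conj_transpose U = conj_transpose V ** conj_transpose ?X"
    using arg_cong[OF comm, of conj_transpose] by (simp only: conj_transpose_mult)
  then have "V ** (conj_transpose ?X ** conj_transpose U) ** U = V ** (conj_transpose V ** conj_transpose ?X) ** U"
    by (simp only:)
  then have comm': "V ** conj_transpose ?X = conj_transpose ?X ** U"
    by (simp only: matrix_mul_assoc unitary_cancel[OF U] unitary_cancel[OF V, unfolded matrix_mul_assoc])
  have a: "U $ p $ q * of_real (x $ q) = of_real (x $ p) * V $ diag_col p $ diag_col q" for p q
    using arg_cong[OF comm, of "\<lambda>M. M $ p $ diag_col q"]
    by (simp add: mult_rect_diag_nth[OF card] rect_diag_mult_nth[OF card])
  have b: "V $ diag_col p $ diag_col q * of_real (x $ q) = of_real (x $ p) * U $ p $ q" for p q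
    using arg_cong[OF comm', of "\<lambda>M. M $ diag_col p $ q"]
    by (simp add: mult_conj_transpose_rect_diag_nth[OF card] conj_transpose_rect_diag_mult_nth[OF card])
  have c: "of_real (x $ p) * V $ diag_col p $ j = 0" if "j \<notin> range (diag_col :: 'm \<Rightarrow> 'n)" for p j
    using arg_cong[OF comm, of "\<lambda>M. M $ p $ j"]
    by (simp add: mult_rect_diag_nth(2)[OF card that] rect_diag_mult_nth[OF card])
  have inside: "U $ p $ q * of_real (y $ q) = of_real (y $ p) * V $ diag_col p $ diag_col q" for p q
  proof (cases "x $ q = 0")
    case True
    then have "x $ p = 0 \<or> V $ diag_col p $ diag_col q = 0"
      using a[of p q] by simp
    then show ?thesis
      using zero True by auto
  next
    case nz: False
    define d where "d = x $ p / x $ q"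
    have xp: "x $ p = d * x $ q" using nz by (simp add: d_def)
    have a': "U $ p $ q = of_real d * V $ diag_col p $ diag_col q"
      and b': "V $ diag_col p $ diag_col q = of_real d * U $ p $ q"
      using a[of p q] b[of p q] nz by (simp_all add: xp)
    show ?thesis
    proof (cases "\<bar>d\<bar> = 1")
      case True
      then have "y $ p = d * y $ q" using y xp by blast
      with a' show ?thesis by simp
    next
      case False
      have "U $ p $ q = of_real (d * d) * U $ p $ q"
        by (subst a', subst b') simp
      moreover have "d * d \<noteq> 1"
        using False by (metis abs_1 abs_mult_self_eq abs_square_eq_1 power2_eq_square)
      then have "of_real (d * d) \<noteq> (1::'a)"
        by (metis of_real_1 of_real_eq_iff)
      ultimately have "U $ p $ q = 0" by (metis mult_cancel_right1)
      with b' show ?thesis by simp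
    qed
  qed
  have outside: "of_real (y $ p) * V $ diag_col p $ j = 0" if "j \<notin> range (diag_col :: 'm \<Rightarrow> 'n)" for p j
    using c[OF that, of p] zero[of p] by auto
  show ?thesis
    unfolding vec_eq_iff
  proof (intro allI)
    fix p j show "(U ** rect_diag y) $ p $ j = (rect_diag y ** V) $ p $ j"
      using inside outside
      by (cases "j \<in> range (diag_col :: 'm \<Rightarrow> 'n)")
        (auto simp: mult_rect_diag_nth[OF card] rect_diag_mult_nth[OF card])
  qed
qed

text \<open>
  The unitary matrices \<open>U'\<^sup>* U\<close> and \<open>V'\<^sup>* V\<close> intertwine with \<open>S(x)\<close>, hence with \<open>S(g x)\<close>.
\<close>

lemma spectral_value_unique:
  fixes U U' :: "'a::real_or_complex^'m::{finite,linorder}^'m::_" and V V' :: "'a^'n::{finite,linorder}^'n::_"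
    and x :: "real^'m::_"
  assumes card: "CARD('m) \<le> CARD('n)"
    and U: "unitary_matrix U" and V: "unitary_matrix V"
    and U': "unitary_matrix U'" and V': "unitary_matrix V'"
    and g: "absolutely_symmetric_on D g" "x \<in> D"
    and eq: "U ** rect_diag x ** conj_transpose V = U' ** rect_diag x ** conj_transpose V'"
  shows "U ** rect_diag (g x) ** conj_transpose V = U' ** rect_diag (g x) ** conj_transpose V'"
proof -
  have "(conj_transpose U' ** U) ** rect_diag x = conj_transpose U' ** (U ** rect_diag x ** conj_transpose V) ** V"
    by (simp only: matrix_mul_assoc[symmetric] unitary_cancel[OF V, unfolded matrix_mul_assoc[symmetric]])
  also have "\<dots> = rect_diag x ** (conj_transpose V' ** V)"
    unfolding eq by (simp only: matrix_mul_assoc[symmetric] unitary_cancel[OF U'])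
  finally have comm: "(conj_transpose U' ** U) ** rect_diag x = rect_diag x ** (conj_transpose V' ** V)" .
  have "(conj_transpose U' ** U) ** rect_diag (g x) = rect_diag (g x) ** (conj_transpose V' ** V)"
  proof (rule rect_diag_commute[OF card _ _ _ comm])
    show "unitary_matrix (conj_transpose U' ** U)" "unitary_matrix (conj_transpose V' ** V)"
      by (simp_all add: U V U' V' unitary_matrix_mult unitary_matrix_conj_transpose)
  qed (rule absolutely_symmetric_on_eq_sign[OF g])
  then have "U' ** ((conj_transpose U' ** U) ** rect_diag (g x)) ** conj_transpose V =
      U' ** (rect_diag (g x) ** (conj_transpose V' ** V)) ** conj_transpose V"
    by (simp only:)
  moreover have "U' ** ((conj_transpose U' ** U) ** rect_diag (g x)) = U ** rect_diag (g x)"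
    by (simp only: matrix_mul_assoc[symmetric] unitary_cancel[OF U'])
  moreover have "U' ** (rect_diag (g x) ** (conj_transpose V' ** V)) ** conj_transpose V =
      U' ** rect_diag (g x) ** conj_transpose V'"
    by (simp only: matrix_mul_assoc unitary_cancel(3)[OF V])
  ultimately show ?thesis by metis
qed

text \<open>
  Sorting the absolute values of \<open>x\<close> by a signed permutation \<open>Q\<close> turns any diagonalization into a
  singular value decomposition. The factors \<open>P\<close> and \<open>R\<close> that implement \<open>Q\<close> on diagonal matrices work
  for all vectors at once, in particular for \<open>g x\<close>.
\<close>

lemma singular_values_signed_permutation:
  fixes U :: "'a::real_or_complex^'m::{finite,linorder}^'m::_" and V :: "'a^'n::{finite,linorder}^'n::_"
  assumes card: "CARD('m) \<le> CARD('n)"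
    and U: "unitary_matrix U" and V: "unitary_matrix V"
    and Z: "Z = U ** rect_diag x ** conj_transpose V"
  obtains Q P and R :: "'a^'n::_^'n::_" where "signed_permutation_matrix Q"
    and "unitary_matrix P" and "unitary_matrix R"
    and "\<forall>y. rect_diag (Q *v y) = P ** rect_diag y ** conj_transpose R"
    and "singular_values Z = Q *v x"
    and "\<forall>i j. i \<le> j \<longrightarrow> singular_values Z $ j \<le> singular_values Z $ i"
    and "\<forall>i. 0 \<le> singular_values Z $ i"
    and "(U ** conj_transpose P, V ** conj_transpose R) \<in> svd_pairs Z"
proof -
  obtain \<pi> :: "'m \<Rightarrow> 'm" where \<pi>: "inj \<pi>"
    "\<And>i j. i \<le> j \<Longrightarrow> \<bar>x $ \<pi> j\<bar> \<le> \<bar>x $ \<pi> i\<bar>"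
    using ex_sorting_permutation[of x] by blast
  define e where "e i = (if x $ \<pi> i < 0 then -1 else 1 :: real)" for i
  have e: "\<bar>e i\<bar> = 1" for i by (simp add: e_def)
  define Q where "Q = monomial_matrix e \<pi>"
  obtain P R where P: "unitary_matrix P" and R: "unitary_matrix (R :: 'a^'n::_^'n::_)"
    and PR: "\<And>y. rect_diag (Q *v y) = P ** rect_diag y ** conj_transpose R"
    unfolding Q_def by (rule rect_diag_signed_permutation[where e = e, OF card \<pi>(1) e]) blast
  have Qx: "(Q *v x) $ i = \<bar>x $ \<pi> i\<bar>" for i
    by (simp add: Q_def monomial_matrix_vector_mult e_def)
  have unitary: "unitary_matrix (U ** conj_transpose P)" "unitary_matrix (V ** conj_transpose R)"
    by (simp_all add: U V P R unitary_matrix_mult unitary_matrix_conj_transpose)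
  have Z': "Z = (U ** conj_transpose P) ** rect_diag (Q *v x) ** conj_transpose (V ** conj_transpose R)"
    unfolding Z PR conj_transpose_mult conj_transpose_conj_transpose
    by (simp only: matrix_mul_assoc[symmetric] unitary_cancel[OF P] unitary_cancel[OF R])
  have sv: "singular_values Z = Q *v x"
    by (rule singular_values_eq[OF card unitary Z']) (simp_all add: Qx \<pi>(2))
  show ?thesis
  proof (rule that)
    show "signed_permutation_matrix Q"
      unfolding Q_def using \<pi>(1) e by (rule signed_permutation_monomial_matrix)
    show "(U ** conj_transpose P, V ** conj_transpose R) \<in> svd_pairs Z"
      unfolding svd_pairs_def mem_Collect_eq prod.case sv using unitary Z' by blast
  qed (use P R PR sv in \<open>simp_all add: Qx \<pi>(2)\<close>)
qed

lemma singular_values_antimono_nonneg: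
  fixes Z :: "'a::real_or_complex^'n::{finite,linorder}^'m::{finite,linorder}"
  assumes card: "CARD('m) \<le> CARD('n)"
  shows singular_values_antimono: "i \<le> j \<Longrightarrow> singular_values Z $ j \<le> singular_values Z $ i"
    and singular_values_nonneg: "0 \<le> singular_values Z $ k"
proof -
  obtain U V x where U: "unitary_matrix U" and V: "unitary_matrix V"
    and Z: "Z = U ** rect_diag x ** conj_transpose V"
    using svd_exists[OF card, of Z] by blast
  show "i \<le> j \<Longrightarrow> singular_values Z $ j \<le> singular_values Z $ i"
    by (rule singular_values_signed_permutation[OF card U V Z]) blast
  show "0 \<le> singular_values Z $ k"
    by (rule singular_values_signed_permutation[OF card U V Z]) blast
qed

lemma svd_pair_exists:
  fixes Z :: "'a::real_or_complex^'n::{finite,linorder}^'m::{finite,linorder}"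
  assumes card: "CARD('m) \<le> CARD('n)"
  shows "\<exists>U V. (U, V) \<in> svd_pairs Z"
proof -
  obtain U V x where U: "unitary_matrix U" and V: "unitary_matrix V"
    and Z: "Z = U ** rect_diag x ** conj_transpose V"
    using svd_exists[OF card, of Z] by blast
  show ?thesis
    by (rule singular_values_signed_permutation[OF card U V Z]) blast
qed

lemma spectral_operator_svd:
  fixes Z :: "'a::real_or_complex^'n::{finite,linorder}^'m::{finite,linorder}"
  assumes card: "CARD('m) \<le> CARD('n)"
    and g: "absolutely_symmetric_on D g" "singular_values Z \<in> D"
    and UV: "(U, V) \<in> svd_pairs Z"
  shows "spectral_operator g Z = U ** rect_diag (g (singular_values Z)) ** conj_transpose V"
  unfolding spectral_operator_def
proof (rule the_equality)
  show "\<exists>(U', V')\<in>svd_pairs Z. U ** rect_diag (g (singular_values Z)) ** conj_transpose V =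
      U' ** rect_diag (g (singular_values Z)) ** conj_transpose V'"
    using UV by blast
  fix Y assume "\<exists>(U', V')\<in>svd_pairs Z. Y = U' ** rect_diag (g (singular_values Z)) ** conj_transpose V'"
  then obtain U' V' where U'V': "(U', V') \<in> svd_pairs Z"
    and Y: "Y = U' ** rect_diag (g (singular_values Z)) ** conj_transpose V'"
    by blast
  show "Y = U ** rect_diag (g (singular_values Z)) ** conj_transpose V"
    unfolding Y
  proof (rule spectral_value_unique[OF card _ _ _ _ g])
    show "U' ** rect_diag (singular_values Z) ** conj_transpose V' =
        U ** rect_diag (singular_values Z) ** conj_transpose V"
      using UV U'V' by (simp add: svd_pairs_def)
  qed (use UV U'V' in \<open>simp_all add: svd_pairs_def\<close>)
qed

text \<open>
  Here the singular values \<open>Q x\<close> of the matrix may lie outside \<open>D\<close>. The value of \<open>G\<close> is nevertheless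
  determined: \<open>g (Q x) = Q (g x)\<close> because \<open>x \<in> D\<close>, and the factors implementing \<open>Q\<close> can be moved
  into the unitary matrices, which reduces every decomposition to one with \<open>x\<close> in the middle.
\<close>

lemma spectral_operator_rect_diag:
  fixes U :: "'a::real_or_complex^'m::{finite,linorder}^'m::_" and V :: "'a^'n::{finite,linorder}^'n::_"
  assumes card: "CARD('m) \<le> CARD('n)"
    and U: "unitary_matrix U" and V: "unitary_matrix V"
    and g: "absolutely_symmetric_on D g" and x: "x \<in> D"
  shows "spectral_operator g (U ** rect_diag x ** conj_transpose V) =
    U ** rect_diag (g x) ** conj_transpose V"
proof -
  define Z where "Z = U ** rect_diag x ** conj_transpose V"
  obtain Q P and R :: "'a^'n::_^'n::_" where Q: "signed_permutation_matrix Q"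
    and P: "unitary_matrix P" and R: "unitary_matrix R"
    and PR: "\<forall>y. rect_diag (Q *v y) = P ** rect_diag y ** conj_transpose R"
    and sv: "singular_values Z = Q *v x"
    and "\<forall>i j. i \<le> j \<longrightarrow> singular_values Z $ j \<le> singular_values Z $ i"
    and "\<forall>i. 0 \<le> singular_values Z $ i"
    and pair: "(U ** conj_transpose P, V ** conj_transpose R) \<in> svd_pairs Z"
    by (rule singular_values_signed_permutation[OF card U V Z_def]) (rule that)
  have gQ: "g (Q *v x) = Q *v g x"
    using g x Q by (simp add: absolutely_symmetric_on_def)
  have assoc: "A ** rect_diag (Q *v y) ** conj_transpose B = (A ** P) ** rect_diag y ** conj_transpose (B ** R)"
    for A y and B :: "'a^'n::_^'n::_"
    by (simp only: PR[rule_format] conj_transpose_mult matrix_mul_assoc)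
  have unique: "Y = U ** rect_diag (g x) ** conj_transpose V"
    if "(A, B) \<in> svd_pairs Z" "Y = A ** rect_diag (g (singular_values Z)) ** conj_transpose B" for A B Y
    unfolding that(2) sv gQ assoc
    using that(1) 
    by (intro spectral_value_unique[OF card _ _ _ _ g x])
       (simp_all add: svd_pairs_def sv assoc unitary_matrix_mult U V P R flip: Z_def)
  show ?thesis
    unfolding spectral_operator_def Z_def[symmetric]
  proof (rule the_equality)
    show "\<exists>(A, B)\<in>svd_pairs Z. U ** rect_diag (g x) ** conj_transpose V =
        A ** rect_diag (g (singular_values Z)) ** conj_transpose B"
      by (rule bexI[OF _ pair]) (simp only: prod.case unique[OF pair refl])
    fix Y assume "\<exists>(A, B)\<in>svd_pairs Z. Y = A ** rect_diag (g (singular_values Z)) ** conj_transpose B"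
    then obtain A B where "(A, B) \<in> svd_pairs Z" "Y = A ** rect_diag (g (singular_values Z)) ** conj_transpose B"
      by blast
    then show "Y = U ** rect_diag (g x) ** conj_transpose V" by (rule unique)
  qed
qed

section \<open>Continuity\<close>

lemma tendsto_rect_diag_iff:
  fixes y :: "real^'m::{finite,linorder}"
  assumes card: "CARD('m) \<le> CARD('n::{finite,linorder})"
  shows "((\<lambda>k. rect_diag (x k) :: 'a::real_or_complex^'n::_^'m::_) \<longlongrightarrow> rect_diag y) F \<longleftrightarrow> (x \<longlongrightarrow> y) F"
proof
  assume lim: "((\<lambda>k. rect_diag (x k) :: 'a::real_or_complex^'n::_^'m::_) \<longlongrightarrow> rect_diag y) F"
  show "(x \<longlongrightarrow> y) F"
  proof (rule vec_tendstoI)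
    fix i
    show "((\<lambda>k. x k $ i) \<longlongrightarrow> y $ i) F"
      using tendsto_vec_nth[OF tendsto_vec_nth[OF lim], of i "diag_col i"]
      by (simp add: rect_diag_nth[OF card] tendsto_of_real_iff)
  qed
next
  assume lim: "(x \<longlongrightarrow> y) F"
  show "((\<lambda>k. rect_diag (x k) :: 'a::real_or_complex^'n::_^'m::_) \<longlongrightarrow> rect_diag y) F"
    by (intro vec_tendstoI) (simp add: rect_diag_nth[OF card] tendsto_of_real_iff tendsto_vec_nth[OF lim])
qed

text \<open>
  Compactness makes the unitary factors converge, and the singular values follow because
  \<open>S(\<sigma>(Z\<^sub>k)) = U\<^sub>k\<^sup>* Z\<^sub>k V\<^sub>k\<close>. Their limit is sorted and nonnegative, so by uniqueness it is
  \<open>\<sigma>(X)\<close>.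
\<close>

lemma svd_subsequence_convergent:
  fixes Z :: "nat \<Rightarrow> 'a::real_or_complex^'n::{finite,linorder}^'m::{finite,linorder}"
  assumes card: "CARD('m) \<le> CARD('n)" and Z: "Z \<longlonglongrightarrow> X"
    and UV: "\<And>k. (U k, V k) \<in> svd_pairs (Z k)"
  obtains r U' V' where "strict_mono r" and "(U', V') \<in> svd_pairs X"
    and "(U \<circ> r) \<longlonglongrightarrow> U'" and "(V \<circ> r) \<longlonglongrightarrow> V'"
    and "(\<lambda>k. singular_values (Z (r k))) \<longlonglongrightarrow> singular_values X"
proof -
  let ?S = "{U :: 'a^'m::_^'m::_. unitary_matrix U} \<times> {V :: 'a^'n::_^'n::_. unitary_matrix V}"
  have UVk: "unitary_matrix (U k)" "unitary_matrix (V k)"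
    "Z k = U k ** rect_diag (singular_values (Z k)) ** conj_transpose (V k)" for k
    using UV[of k] by (simp_all add: svd_pairs_def)
  have "seq_compact ?S"
    by (intro compact_imp_seq_compact compact_Times compact_unitary_matrices)
  moreover have "\<forall>k. (U k, V k) \<in> ?S"
    using UVk by simp
  ultimately obtain P r where P: "P \<in> ?S" and r: "strict_mono r" and lim: "((\<lambda>k. (U k, V k)) \<circ> r) \<longlonglongrightarrow> P"
    by (rule seq_compactE)
  obtain U' V' where UV': "P = (U', V')" by (cases P)
  have unitary: "unitary_matrix U'" "unitary_matrix V'"
    using P by (simp_all add: UV')
  have limU: "(\<lambda>k. U (r k)) \<longlonglongrightarrow> U'" and limV: "(\<lambda>k. V (r k)) \<longlonglongrightarrow> V'"
    using tendsto_fst[OF lim] tendsto_snd[OF lim] by (simp_all add: UV' o_def)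
  have limZ: "(\<lambda>k. Z (r k)) \<longlonglongrightarrow> X"
    using LIMSEQ_subseq_LIMSEQ[OF Z r] by (simp add: o_def)
  let ?s = "\<lambda>k. singular_values (Z (r k))"
  have diag: "rect_diag (?s k) = conj_transpose (U (r k)) ** Z (r k) ** V (r k)" for k
    by (subst (2) UVk(3))
      (simp only: matrix_mul_assoc[symmetric] unitary_cancel[OF UVk(1)],
       simp only: matrix_mul_assoc unitary_cancel[OF UVk(2)])
  define W where "W = conj_transpose U' ** X ** V'"
  have limW: "(\<lambda>k. rect_diag (?s k) :: 'a^'n::_^'m::_) \<longlonglongrightarrow> W"
    unfolding diag W_def by (intro tendsto_matrix_mult tendsto_conj_transpose limU limV limZ)
  \<comment> \<open>the inner product with \<open>1\<close> is the real part, which recovers \<open>x\<close> from \<open>of_real x\<close>\<close>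
  define s where "s = (\<chi> i. inner (W $ i $ diag_col i) 1)"
  have lims: "?s \<longlonglongrightarrow> s"
  proof (rule vec_tendstoI)
    fix i
    have "(\<lambda>k. inner ((rect_diag (?s k) :: 'a^'n::_^'m::_) $ i $ diag_col i) 1) \<longlonglongrightarrow> s $ i"
      unfolding s_def vec_lambda_beta by (intro tendsto_intros limW)
    then show "(\<lambda>k. ?s k $ i) \<longlonglongrightarrow> s $ i"
      by (simp add: rect_diag_nth[OF card] of_real_def dot_square_norm)
  qed
  have W: "W = rect_diag s"
    using limW lims tendsto_rect_diag_iff[OF card] LIMSEQ_unique by blast
  have X: "X = U' ** rect_diag s ** conj_transpose V'"
    unfolding W[symmetric] W_def
    by (simp only: matrix_mul_assoc[symmetric] unitary_cancel[OF unitary(1)])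
      (simp only: matrix_mul_assoc unitary_cancel[OF unitary(2)])
  have "singular_values X = s"
  proof (rule singular_values_eq[OF card unitary X])
    show "s $ j \<le> s $ i" if "i \<le> j" for i j
      using singular_values_antimono[OF card that]
      by (intro LIMSEQ_le[OF tendsto_vec_nth[OF lims] tendsto_vec_nth[OF lims]]) blast
    show "0 \<le> s $ i" for i
      using singular_values_nonneg[OF card]
      by (intro LIMSEQ_le_const[OF tendsto_vec_nth[OF lims]]) blast
  qed
  with X unitary r limU limV lims show ?thesis
    by (intro that[of r U' V']) (simp_all add: svd_pairs_def o_def)
qed

theorem theorem3p1:
  fixes N :: "('a::real_or_complex^'n::{finite,linorder}^'m::{finite,linorder}) set"
    and D :: "(real^'m::_) set"
    and g :: "real^'m::_ \<Rightarrow> real^'m::_"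
    and X :: "'a^'n::_^'m::_"
  assumes "CARD('m) \<le> CARD('n)"
    and "open N" and "N \<noteq> {}"
    and "open D" and "singular_values ` N \<subseteq> D"
    and "absolutely_symmetric_on D g"
    and "X \<in> N"
  shows "continuous (at X within N) (spectral_operator g) \<longleftrightarrow>
         continuous (at (singular_values X)) g"
proof
  note card = assms(1)
  let ?s = "singular_values X" and ?G = "spectral_operator g :: 'a^'n::_^'m::_ \<Rightarrow> _"
  obtain U V where UV: "(U, V) \<in> svd_pairs X"
    using svd_pair_exists[OF card, of X] by blast
  then have U: "unitary_matrix U" and V: "unitary_matrix V"
    and X: "X = U ** rect_diag ?s ** conj_transpose V"
    by (simp_all add: svd_pairs_def)
  have GX: "?G X = U ** rect_diag (g ?s) ** conj_transpose V"
    using assms(5,7) by (intro spectral_operator_svd[OF card assms(6) _ UV]) auto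
  assume "continuous (at X within N) ?G"
  then have G: "isCont ?G X"
    using at_within_open[OF assms(7,2)] by simp
  have "((\<lambda>x. rect_diag x :: 'a^'n::_^'m::_) \<longlongrightarrow> rect_diag ?s) (at ?s)"
    unfolding tendsto_rect_diag_iff[OF card] by (rule tendsto_ident_at)
  then have "((\<lambda>x. U ** rect_diag x ** conj_transpose V) \<longlongrightarrow> U ** rect_diag ?s ** conj_transpose V) (at ?s)"
    by (intro tendsto_matrix_mult tendsto_const)
  then have "((\<lambda>x. ?G (U ** rect_diag x ** conj_transpose V)) \<longlongrightarrow> ?G X) (at ?s)"
    unfolding X[symmetric] by (rule isCont_tendsto_compose[OF G])
  then have "((\<lambda>x. conj_transpose U ** ?G (U ** rect_diag x ** conj_transpose V) ** V) \<longlongrightarrow>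
      conj_transpose U ** ?G X ** V) (at ?s)"
    by (intro tendsto_matrix_mult tendsto_const)
  moreover have cancel: "conj_transpose U ** (U ** A ** conj_transpose V) ** V = A" for A
    by (simp only: matrix_mul_assoc[symmetric] unitary_cancel[OF U])
      (simp only: matrix_mul_assoc unitary_cancel[OF V])
  \<comment> \<open>the identity for \<open>G\<close> holds only for \<open>x \<in> D\<close>, and here openness of \<open>D\<close> is used\<close>
  have "\<forall>\<^sub>F x in at ?s. x \<in> D"
    using assms(4,5,7) by (intro eventually_at_in_open') auto
  then have "\<forall>\<^sub>F x in at ?s. conj_transpose U ** ?G (U ** rect_diag x ** conj_transpose V) ** V =
      rect_diag (g x)"
    by eventually_elim (simp add: spectral_operator_rect_diag[OF card U V assms(6)] cancel)
  ultimately have "((\<lambda>x. rect_diag (g x) :: 'a^'n::_^'m::_) \<longlongrightarrow> rect_diag (g ?s)) (at ?s)"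
    unfolding GX cancel by (rule Lim_transform_eventually)
  then show "continuous (at ?s) g"
    unfolding tendsto_rect_diag_iff[OF card] by (simp add: isCont_def)
next
  note card = assms(1)
  let ?G = "spectral_operator g :: 'a^'n::_^'m::_ \<Rightarrow> _"
  assume g: "continuous (at (singular_values X)) g"
  show "continuous (at X within N) ?G"
  proof (rule ccontr)
    assume "\<not> continuous (at X within N) ?G"
    then obtain \<epsilon> where \<epsilon>: "\<epsilon> > 0"
      and bad: "\<And>\<delta>. \<delta> > 0 \<Longrightarrow> \<exists>Z\<in>N. dist Z X < \<delta> \<and> \<epsilon> \<le> dist (?G Z) (?G X)"
      unfolding continuous_within_eps_delta by (meson not_less)
    have "\<forall>k. \<exists>Z\<in>N. dist Z X < inverse (real (Suc k)) \<and> \<epsilon> \<le> dist (?G Z) (?G X)"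
      using bad by simp
    then obtain Z where Z: "\<And>k. Z k \<in> N" "\<And>k. dist (Z k) X < inverse (real (Suc k))"
      "\<And>k. \<epsilon> \<le> dist (?G (Z k)) (?G X)"
      by metis
    have "(\<lambda>k. dist (Z k) X) \<longlonglongrightarrow> 0"
      by (rule tendsto_sandwich[OF _ _ tendsto_const LIMSEQ_inverse_real_of_nat])
        (simp_all add: less_imp_le[OF Z(2)] del: of_nat_Suc)
    then have limZ: "Z \<longlonglongrightarrow> X"
      by (rule tendsto_dist_iff[THEN iffD2])
    have "\<forall>k. \<exists>U V. (U, V) \<in> svd_pairs (Z k)"
      by (intro allI svd_pair_exists[OF card])
    then obtain U V where UV: "\<And>k. (U k, V k) \<in> svd_pairs (Z k)" by metis
    obtain r U' V' where UV': "(U', V') \<in> svd_pairs X"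
      and lim: "(U \<circ> r) \<longlonglongrightarrow> U'" "(V \<circ> r) \<longlonglongrightarrow> V'"
        "(\<lambda>k. singular_values (Z (r k))) \<longlonglongrightarrow> singular_values X"
      using svd_subsequence_convergent[OF card limZ UV] by metis
    have G: "?G (Z k) = U k ** rect_diag (g (singular_values (Z k))) ** conj_transpose (V k)" for k
      using assms(5) Z(1) by (intro spectral_operator_svd[OF card assms(6) _ UV]) auto
    have GX: "?G X = U' ** rect_diag (g (singular_values X)) ** conj_transpose V'"
      using assms(5,7) by (intro spectral_operator_svd[OF card assms(6) _ UV']) auto
    have "(\<lambda>k. g (singular_values (Z (r k)))) \<longlonglongrightarrow> g (singular_values X)"
      using g lim(3) by (rule isCont_tendsto_compose)
    then have "(\<lambda>k. rect_diag (g (singular_values (Z (r k)))) :: 'a^'n::_^'m::_)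
        \<longlonglongrightarrow> rect_diag (g (singular_values X))"
      by (simp add: tendsto_rect_diag_iff[OF card])
    then have "(\<lambda>k. ?G (Z (r k))) \<longlonglongrightarrow> ?G X"
      unfolding G GX using lim(1,2)
      by (intro tendsto_matrix_mult tendsto_conj_transpose) (simp_all add: o_def)
    then obtain k where "dist (?G (Z (r k))) (?G X) < \<epsilon>"
      using metric_LIMSEQ_D[OF _ \<epsilon>] by blast
    with Z(3)[of "r k"] show False by simp
  qed
qed

end
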